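(* Let $\mathbb{T}=(\Sigma,\mathcal{E})$ be a graded theory and $n\le\omega$. An inequation in context $\Gamma\vdash_k s\le t$ is derivable (in the logic of inequations in context for $\mathbb{T}$) if and only if it is satisfied by every $(\mathbb{T},n)$-model.
   Context: $\mathsf{Pos}$: posets and monotone maps; $\mathsf{Pos}(P,A)$ the poset of monotone maps $P\to A$ ordered pointwise; $|A|$ the underlying set. A graded signature $\Sigma$ consists of sets $\Sigma(P,n)$ of operation symbols for finite posets $P$ and $n\in\omega$; for $\sigma\in\Sigma(P,n)$, $\mathrm{ar}(\sigma)=P$, $d(\sigma)=n$. For a poset $\Gamma$ (context), terms $\mathsf{T}_{\Sigma,k}(\Gamma)$ of uniform depth $k$: each $x\in\Gamma$ has depth $0$; for $\sigma\in\Sigma(P,k)$ and any function $f\colon|P|\to\mathsf{T}_{\Sigma,m}(\Gamma)$, $\sigma(f)$ has depth $k+m$. Subterms: $\mathsf{sub}(x)=\{x\}$, $\mathsf{sub}(\sigma(f))=\{\sigma(f)\}\cup\bigcup_i\mathsf{sub}(f(i))$, $\mathsf{sub}(s,t)=\mathsf{sub}(s)\cup\mathsf{sub}(t)$. For $n\le\omega$, a $(\Sigma,n)$-algebra $A$: posets $A_k$ ($k\le n$, $k<\omega$) and monotone $\sigma^A_k\colon\mathsf{Pos}(\mathrm{ar}(\sigma),A_k)\to A_{d(\sigma)+k}$ whenever $d(\sigma)+k\le n$. For monotone $\iota\colon\Gamma\to A_m$, the evaluation is the family of partial maps $\iota^\#_k\colon\mathsf{T}_{\Sigma,k}(\Gamma)\to|A_{m+k}|$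 ($m+k\le n$): $\iota^\#_0(x)=\iota(x)$; for $f\colon|\mathrm{ar}(\sigma)|\to\mathsf{T}_{\Sigma,q}(\Gamma)$, $q+d(\sigma)=k$, $\iota^\#_k(\sigma(f))$ is defined iff all $\iota^\#_q(f(i))$ are defined and $i\le j$ in $\mathrm{ar}(\sigma)$ implies $\iota^\#_q(f(i))\le\iota^\#_q(f(j))$, and then equals $\sigma^A_q(\iota^\#_q\cdot f)$. A depth-$k$ inequation in context $\Gamma$ is a pair $s,t\in\mathsf{T}_{\Sigma,k}(\Gamma)$, written $\Gamma\vdash_k s\le t$; $\Gamma\vdash_k{\downarrow}t$ abbreviates $\Gamma\vdash_k t\le t$. $A$ satisfies it if for every monotone $\iota\colon\Gamma\to A_m$ with $m+k\le n$, $\iota^\#_k(s)$ and $\iota^\#_k(t)$ are defined and $\iota^\#_k(s)\le\iota^\#_k(t)$. A graded theory $\mathbb{T}=(\Sigma,\mathcal{E})$ has a set $\mathcal{E}$ of inequations (axioms); a $(\mathbb{T},n)$-model is a $(\Sigma,n)$-algebra satisfying all axioms. A uniform substitution is a function $\gamma\colon|\Delta|\to\mathsf{T}_{\Sigma,k}(\Gamma)$; it extends to $\bar\gamma\colon\mathsf{T}_{\Sigma,p}(\Delta)\to\mathsf{T}_{\Sigma,k+p}(\Gamma)$ by $\bar\gamma(x)=\gamma(x)$, $\bar\gamma(\sigma(f))=\sigma(\bar\gamma\cdot f)$. Derivable inequations are generated by the rules: (Var) $\Gamma\vdash_0 x\le y$ for $x\le y$ in $\Gamma$. (Ar) for $f\colon|\mathrm{ar}(\sigma)|\to\mathsf{T}_{\Sigma,k}(\Gamma)$: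 from $\Gamma\vdash_k f(i)\le f(j)$ for all $i\le j$ in $\mathrm{ar}(\sigma)$ infer $\Gamma\vdash_{k+d(\sigma)}{\downarrow}\sigma(f)$. (Trans) from $\Gamma\vdash_k s\le t$ and $\Gamma\vdash_k t\le u$ infer $\Gamma\vdash_k s\le u$. (Mon) for $f,g\colon|\mathrm{ar}(\sigma)|\to\mathsf{T}_{\Sigma,k}(\Gamma)$: from $\Gamma\vdash_k f(i)\le g(i)$ for all $i$, $\Gamma\vdash_{k+d(\sigma)}{\downarrow}\sigma(f)$ and $\Gamma\vdash_{k+d(\sigma)}{\downarrow}\sigma(g)$ infer $\Gamma\vdash_{k+d(\sigma)}\sigma(f)\le\sigma(g)$. (Ax1) for an axiom $\Delta\vdash_n s\le t$ in $\mathcal{E}$ and uniform substitution $\gamma\colon|\Delta|\to\mathsf{T}_{\Sigma,k}(\Gamma)$: from $\Gamma\vdash_k\gamma(x)\le\gamma(y)$ for all $x\le y$ in $\Delta$ infer $\Gamma\vdash_{n+k}\bar\gamma(s)\le\bar\gamma(t)$. (Ax2) for an axiom $\Delta\vdash_n s\le t$ in $\mathcal{E}$, a subterm $\sigma(f)\in\mathsf{sub}(s,t)$ with $f\colon|\mathrm{ar}(\sigma)|\to\mathsf{T}_{\Sigma,m}(\Delta)$, $i\le j$ in $\mathrm{ar}(\sigma)$, and a uniform substitution $\gamma\colon|\Delta|\to\mathsf{T}_{\Sigma,k}(\Gamma)$: from $\Gamma\vdash_k\gamma(x)\le\gamma(y)$ for all $x\le y$ in $\Delta$ infer $\Gamm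a\vdash_{m+k}\bar\gamma(f(i))\le\bar\gamma(f(j))$.
   Formalization: For finite n the claim fails as stated; "satisfied implies derivable" is proved for k ≤ n, and "derivable implies satisfied" assumes that all (T,n)-models satisfy Δ ⊢_m f(i) ≤ f(j) for subterms σ(f) of axioms and i ≤ j in ar(σ). For n = ω it is the full equivalence. *)

theory Defs
  imports Main "HOL-Library.FuncSet" "HOL-Library.Extended_Nat"
begin

text \<open>
  A poset is a relation \<open>r\<close> with \<open>Partial_order r\<close>; reflexivity makes \<open>Field r\<close> its underlying set,
  so that the relation alone determines the poset. Functions out of an underlying set are
  extensional, so that two of them are equal iff they agree on that set.
\<close>

definition Pos :: "'p rel \<Rightarrow> 'a rel \<Rightarrow> ('p \<Rightarrow> 'a) set" where
  "Pos P A = {f \<in> Field P \<rightarrow>\<^sub>E Field A. \<forall>(i, j) \<in> P. (f i, f j) \<in> A}"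

text \<open>\<open>\<Sigma>(P, n)\<close> is \<open>{\<sigma> \<in> symbols \<Sigma>. ar \<Sigma> \<sigma> = P \<and> dp \<Sigma> \<sigma> = n}\<close>.\<close>

record ('o, 'p) signature =
  symbols :: "'o set"
  ar :: "'o \<Rightarrow> 'p rel"
  dp :: "'o \<Rightarrow> nat"

definition graded_signature :: "('o, 'p) signature \<Rightarrow> bool" where
  "graded_signature \<Sigma> \<longleftrightarrow>
     (\<forall>\<sigma> \<in> symbols \<Sigma>. Partial_order (ar \<Sigma> \<sigma>) \<and> finite (Field (ar \<Sigma> \<sigma>)))"

text \<open>
  In \<open>Op \<sigma> m f\<close> the number \<open>m\<close> records the codomain of \<open>f : |ar(\<sigma>)| \<rightarrow> T\<^sub>m(\<Gamma>)\<close>. It is determined by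
  \<open>f\<close> unless the arity is empty; there it keeps apart the copies of a constant in different
  depths, so that every term has exactly one depth.
\<close>

datatype ('o, 'p, 'x) gterm =
    Var 'x
  | Op 'o nat "'p \<Rightarrow> ('o, 'p, 'x) gterm"

inductive is_term :: "('o, 'p) signature \<Rightarrow> 'x rel \<Rightarrow> nat \<Rightarrow> ('o, 'p, 'x) gterm \<Rightarrow> bool"
  for \<Sigma> :: "('o, 'p) signature" and \<Gamma> :: "'x rel" where
  is_term_Var: "x \<in> Field \<Gamma> \<Longrightarrow> is_term \<Sigma> \<Gamma> 0 (Var x)"
| is_term_Op: "\<lbrakk>\<sigma> \<in> symbols \<Sigma>; f \<in> extensional (Field (ar \<Sigma> \<sigma>));
      \<And>i. i \<in> Field (ar \<Sigma> \<sigma>) \<Longrightarrow> is_term \<Sigma> \<Gamma> m (f i)\<rbrakk>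
    \<Longrightarrow> is_term \<Sigma> \<Gamma> (dp \<Sigma> \<sigma> + m) (Op \<sigma> m f)"

definition terms :: "('o, 'p) signature \<Rightarrow> 'x rel \<Rightarrow> nat \<Rightarrow> ('o, 'p, 'x) gterm set" where
  "terms \<Sigma> \<Gamma> k = {t. is_term \<Sigma> \<Gamma> k t}"

primrec sub :: "('o, 'p) signature \<Rightarrow> ('o, 'p, 'x) gterm \<Rightarrow> ('o, 'p, 'x) gterm set" where
  "sub \<Sigma> (Var x) = {Var x}"
| "sub \<Sigma> (Op \<sigma> m f) = {Op \<sigma> m f} \<union> (\<Union>i \<in> Field (ar \<Sigma> \<sigma>). sub \<Sigma> (f i))"

text \<open>\<open>subst \<Sigma> k \<gamma>\<close> extends a uniform substitution \<open>\<gamma> : |\<Delta>| \<rightarrow> T\<^sub>k(\<Gamma>)\<close>.\<close>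

primrec subst :: "('o, 'p) signature \<Rightarrow> nat \<Rightarrow> ('v \<Rightarrow> ('o, 'p, 'x) gterm)
    \<Rightarrow> ('o, 'p, 'v) gterm \<Rightarrow> ('o, 'p, 'x) gterm" where
  "subst \<Sigma> k \<gamma> (Var x) = \<gamma> x"
| "subst \<Sigma> k \<gamma> (Op \<sigma> m f) =
     Op \<sigma> (k + m) (restrict (\<lambda>i. subst \<Sigma> k \<gamma> (f i)) (Field (ar \<Sigma> \<sigma>)))"

text \<open>\<open>(\<Gamma>, k, s, t)\<close> stands for \<open>\<Gamma> \<turnstile>\<^sub>k s \<le> t\<close>.\<close>

type_synonym ('o, 'p, 'x) ineq =
  "'x rel \<times> nat \<times> ('o, 'p, 'x) gterm \<times> ('o, 'p, 'x) gterm"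

definition inequation :: "('o, 'p) signature \<Rightarrow> ('o, 'p, 'x) ineq \<Rightarrow> bool" where
  "inequation \<Sigma> = (\<lambda>(\<Gamma>, k, s, t).
     Partial_order \<Gamma> \<and> s \<in> terms \<Sigma> \<Gamma> k \<and> t \<in> terms \<Sigma> \<Gamma> k)"

definition graded_theory :: "('o, 'p) signature \<Rightarrow> ('o, 'p, 'v) ineq set \<Rightarrow> bool" where
  "graded_theory \<Sigma> \<E> \<longleftrightarrow> graded_signature \<Sigma> \<and> (\<forall>e \<in> \<E>. inequation \<Sigma> e)"

inductive derivable :: "('o, 'p) signature \<Rightarrow> ('o, 'p, 'v) ineq set \<Rightarrow> 'x rel \<Rightarrow> nat
    \<Rightarrow> ('o, 'p, 'x) gterm \<Rightarrow> ('o, 'p, 'x) gterm \<Rightarrow> bool"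
  for \<Sigma> :: "('o, 'p) signature" and \<E> :: "('o, 'p, 'v) ineq set" and \<Gamma> :: "'x rel" where
  Var: "(x, y) \<in> \<Gamma> \<Longrightarrow> derivable \<Sigma> \<E> \<Gamma> 0 (Var x) (Var y)"
| Ar: "\<lbrakk>\<sigma> \<in> symbols \<Sigma>; f \<in> Field (ar \<Sigma> \<sigma>) \<rightarrow>\<^sub>E terms \<Sigma> \<Gamma> k;
      \<And>i j. (i, j) \<in> ar \<Sigma> \<sigma> \<Longrightarrow> derivable \<Sigma> \<E> \<Gamma> k (f i) (f j)\<rbrakk>
    \<Longrightarrow> derivable \<Sigma> \<E> \<Gamma> (k + dp \<Sigma> \<sigma>) (Op \<sigma> k f) (Op \<sigma> k f)"
| Trans: "\<lbrakk>derivable \<Sigma> \<E> \<Gamma> k s t; derivable \<Sigma> \<E> \<Gamma> k t u\<rbrakk> \<Longrightarrow> derivable \<Sigma> \<E> \<Gamma> k s u"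
| Mon: "\<lbrakk>\<sigma> \<in> symbols \<Sigma>; f \<in> Field (ar \<Sigma> \<sigma>) \<rightarrow>\<^sub>E terms \<Sigma> \<Gamma> k; g \<in> Field (ar \<Sigma> \<sigma>) \<rightarrow>\<^sub>E terms \<Sigma> \<Gamma> k;
      \<And>i. i \<in> Field (ar \<Sigma> \<sigma>) \<Longrightarrow> derivable \<Sigma> \<E> \<Gamma> k (f i) (g i);
      derivable \<Sigma> \<E> \<Gamma> (k + dp \<Sigma> \<sigma>) (Op \<sigma> k f) (Op \<sigma> k f);
      derivable \<Sigma> \<E> \<Gamma> (k + dp \<Sigma> \<sigma>) (Op \<sigma> k g) (Op \<sigma> k g)\<rbrakk>
    \<Longrightarrow> derivable \<Sigma> \<E> \<Gamma> (k + dp \<Sigma> \<sigma>) (Op \<sigma> k f) (Op \<sigma> k g)"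
| Ax1: "\<lbrakk>(\<Delta>, p, s, t) \<in> \<E>; \<gamma> ` Field \<Delta> \<subseteq> terms \<Sigma> \<Gamma> k;
      \<And>x y. (x, y) \<in> \<Delta> \<Longrightarrow> derivable \<Sigma> \<E> \<Gamma> k (\<gamma> x) (\<gamma> y)\<rbrakk>
    \<Longrightarrow> derivable \<Sigma> \<E> \<Gamma> (p + k) (subst \<Sigma> k \<gamma> s) (subst \<Sigma> k \<gamma> t)"
| Ax2: "\<lbrakk>(\<Delta>, p, s, t) \<in> \<E>; Op \<sigma> m f \<in> sub \<Sigma> s \<union> sub \<Sigma> t; (i, j) \<in> ar \<Sigma> \<sigma>;
      \<gamma> ` Field \<Delta> \<subseteq> terms \<Sigma> \<Gamma> k;
      \<And>x y. (x, y) \<in> \<Delta> \<Longrightarrow> derivable \<Sigma> \<E> \<Gamma> k (\<gamma> x) (\<gamma> y)\<rbrakk>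
    \<Longrightarrow> derivable \<Sigma> \<E> \<Gamma> (m + k) (subst \<Sigma> k \<gamma> (f i)) (subst \<Sigma> k \<gamma> (f j))"

text \<open>
  The components with index above \<open>n\<close>, and the values of operations outside the domains
  \<open>Pos (ar \<Sigma> \<sigma>) (car A k)\<close>, are irrelevant junk.
\<close>

record ('o, 'p, 'a) galg =
  car :: "nat \<Rightarrow> 'a rel"
  opn :: "'o \<Rightarrow> nat \<Rightarrow> ('p \<Rightarrow> 'a) \<Rightarrow> 'a"

definition algebra :: "('o, 'p) signature \<Rightarrow> enat \<Rightarrow> ('o, 'p, 'a) galg \<Rightarrow> bool" where
  "algebra \<Sigma> n A \<longleftrightarrow>
     (\<forall>k. enat k \<le> n \<longrightarrow> Partial_order (car A k)) \<and>
     (\<forall>\<sigma> \<in> symbols \<Sigma>. \<forall>k. enat (dp \<Sigma> \<sigma> + k) \<le> n \<longrightarrow>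
        (\<forall>f \<in> Pos (ar \<Sigma> \<sigma>) (car A k). opn A \<sigma> k f \<in> Field (car A (dp \<Sigma> \<sigma> + k))) \<and>
        (\<forall>f \<in> Pos (ar \<Sigma> \<sigma>) (car A k). \<forall>g \<in> Pos (ar \<Sigma> \<sigma>) (car A k).
           (\<forall>i \<in> Field (ar \<Sigma> \<sigma>). (f i, g i) \<in> car A k) \<longrightarrow>
           (opn A \<sigma> k f, opn A \<sigma> k g) \<in> car A (dp \<Sigma> \<sigma> + k)))"

text \<open>
  \<open>eval \<Sigma> A m \<iota> t\<close> is the value of \<open>t\<close> under \<open>\<iota> : \<Gamma> \<rightarrow> A\<^sub>m\<close>. Arguments of depth \<open>q\<close> take their values in
  \<open>A\<^sub>m\<^sub>+\<^sub>q\<close>, so it is the operation with index \<open>m + q\<close> that gets applied.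
\<close>

primrec eval :: "('o, 'p) signature \<Rightarrow> ('o, 'p, 'a) galg \<Rightarrow> nat \<Rightarrow> ('x \<Rightarrow> 'a)
    \<Rightarrow> ('o, 'p, 'x) gterm \<Rightarrow> 'a option" where
  "eval \<Sigma> A m \<iota> (Var x) = Some (\<iota> x)"
| "eval \<Sigma> A m \<iota> (Op \<sigma> q f) =
    (if (\<forall>i \<in> Field (ar \<Sigma> \<sigma>). eval \<Sigma> A m \<iota> (f i) \<noteq> None) \<and>
        (\<forall>(i, j) \<in> ar \<Sigma> \<sigma>. (the (eval \<Sigma> A m \<iota> (f i)), the (eval \<Sigma> A m \<iota> (f j))) \<in> car A (m + q))
     then Some (opn A \<sigma> (m + q) (restrict (\<lambda>i. the (eval \<Sigma> A m \<iota> (f i))) (Field (ar \<Sigma> \<sigma>))))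
     else None)"

definition satisfies :: "('o, 'p) signature \<Rightarrow> enat \<Rightarrow> ('o, 'p, 'a) galg
    \<Rightarrow> ('o, 'p, 'x) ineq \<Rightarrow> bool" where
  "satisfies \<Sigma> n A = (\<lambda>(\<Gamma>, k, s, t).
     \<forall>m. enat (m + k) \<le> n \<longrightarrow> (\<forall>\<iota> \<in> Pos \<Gamma> (car A m).
       \<exists>a b. eval \<Sigma> A m \<iota> s = Some a \<and> eval \<Sigma> A m \<iota> t = Some b \<and> (a, b) \<in> car A (m + k)))"

definition model :: "('o, 'p) signature \<Rightarrow> ('o, 'p, 'v) ineq set \<Rightarrow> enat
    \<Rightarrow> ('o, 'p, 'a) galg \<Rightarrow> bool" where
  "model \<Sigma> \<E> n A \<longleftrightarrow> algebra \<Sigma> n A \<and> (\<forall>e \<in> \<E>. satisfies \<Sigma> n A e)"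

text \<open>
  The inequations \<open>\<Delta> \<turnstile>\<^sub>m f(i) \<le> f(j)\<close> that (Ax2) derives with the identity substitution. If an axiom of
  depth \<open>p\<close> holds in an \<open>\<omega>\<close>-algebra then so do these. In an \<open>n\<close>-algebra with \<open>n\<close> finite they may
  fail: the axiom speaks only about \<open>\<iota> : \<Delta> \<rightarrow> A\<^sub>k\<close> with \<open>k + p \<le> n\<close>, and \<open>m\<close> may be smaller than \<open>p\<close>.
\<close>

definition argument_ineqs ::
    "('o, 'p) signature \<Rightarrow> ('o, 'p, 'v) ineq set \<Rightarrow> ('o, 'p, 'v) ineq set" where
  "argument_ineqs \<Sigma> \<E> = {(\<Delta>, m, f i, f j) | \<Delta> p s t \<sigma> m f i j.
     (\<Delta>, p, s, t) \<in> \<E> \<and> Op \<sigma> m f \<in> sub \<Sigma> s \<union> sub \<Sigma> t \<and> (i, j) \<in> ar \<Sigma> \<sigma>}"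

end

theory Submission
  imports Defs
begin

text \<open>
  Soundness is an induction on derivations, in which evaluation turns a substitution into a change of
  valuation. For completeness, the terms \<open>t\<close> of depth \<open>k\<close> with \<open>\<Gamma> \<turnstile>\<^sub>k \<down>t\<close>, modulo derivable inequality
  in both directions, form a model \<open>F\<close>: (Ar) and (Mon) make the operations total and monotone,
  (Ax2) makes both sides of an axiom defined, and (Ax1) makes it hold. Under \<open>x \<mapsto> [x]\<close> a term can only
  evaluate to its own class, so that an inequation satisfied by \<open>F\<close> is derivable.
\<close>

section \<open>Posets and monotone maps\<close>

lemma Field_refl: "Partial_order r \<Longrightarrow> x \<in> Field r \<Longrightarrow> (x, x) \<in> r"
  by (auto simp: partial_order_on_def preorder_on_def refl_on_def)

lemma Partial_order_trans: "Partial_order r \<Longrightarrow> (x, y) \<in> r \<Longrightarrow> (y, z) \<in> r \<Longrightarrow> (x, z) \<in> r"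
  unfolding partial_order_on_def preorder_on_def by (meson transD)

lemma Pos_mono: "f \<in> Pos P A \<Longrightarrow> (i, j) \<in> P \<Longrightarrow> (f i, f j) \<in> A"
  by (auto simp: Pos_def)

text \<open>By reflexivity of \<open>P\<close>, the hypothesis at \<open>(i, i)\<close> already
  places \<open>f i\<close> in \<open>Field A\<close>, so monotonicity alone yields an element of
  \<open>Pos P A\<close>.\<close>

lemma restrict_in_Pos:
  assumes "Partial_order P" "\<And>i j. (i, j) \<in> P \<Longrightarrow> (f i, f j) \<in> A"
  shows "restrict f (Field P) \<in> Pos P A"
proof -
  have "f i \<in> Field A" if "i \<in> Field P" for i
    using assms(2)[OF Field_refl[OF assms(1) that]] by (rule FieldI1)
  moreover have "(restrict f (Field P) i, restrict f (Field P) j) \<in> A" if "(i, j) \<in> P" for i j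
    using assms(2)[OF that] FieldI1[OF that] FieldI2[OF that] by simp
  ultimately show ?thesis
    unfolding Pos_def by (auto simp del: restrict_apply simp: PiE_def)
qed

section \<open>Terms, subterms and substitution\<close>

lemma is_term_OpD:
  assumes "is_term \<Sigma> \<Gamma> k (Op \<sigma> m f)"
  shows "k = dp \<Sigma> \<sigma> + m" "\<sigma> \<in> symbols \<Sigma>" "f \<in> extensional (Field (ar \<Sigma> \<sigma>))"
    "\<And>i. i \<in> Field (ar \<Sigma> \<sigma>) \<Longrightarrow> is_term \<Sigma> \<Gamma> m (f i)"
  using assms by (auto elim: is_term.cases)

lemma is_term_VarD: "is_term \<Sigma> \<Gamma> k (Var x) \<Longrightarrow> k = 0 \<and> x \<in> Field \<Gamma>"
  by (auto elim: is_term.cases)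

lemma is_term_sub:
  assumes "is_term \<Sigma> \<Gamma> k t" "u \<in> sub \<Sigma> t"
  shows "\<exists>q. is_term \<Sigma> \<Gamma> q u"
  using assms by (induction arbitrary: u rule: is_term.induct) (auto intro: is_term.intros)

lemma sub_refl: "t \<in> sub \<Sigma> t"
  by (cases t) auto

lemma sub_arg:
  assumes "Op \<sigma> m f \<in> sub \<Sigma> t" "i \<in> Field (ar \<Sigma> \<sigma>)"
  shows "f i \<in> sub \<Sigma> t"
  using assms
proof (induction t)
  case (Op \<tau> q g)
  then show ?case by (cases "Op \<sigma> m f = Op \<tau> q g") (auto intro: sub_refl)
qed simp

lemma subst_in_terms:
  assumes "is_term \<Sigma> \<Delta> p t" "\<gamma> ` Field \<Delta> \<subseteq> terms \<Sigma> \<Gamma> k"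
  shows "subst \<Sigma> k \<gamma> t \<in> terms \<Sigma> \<Gamma> (k + p)"
  using assms(1)
proof induction
  case (is_term_Var x)
  then show ?case using assms(2) by (auto simp: terms_def)
next
  case (is_term_Op \<sigma> f m)
  then have "is_term \<Sigma> \<Gamma> (dp \<Sigma> \<sigma> + (k + m)) (subst \<Sigma> k \<gamma> (Op \<sigma> m f))"
    by (auto simp: terms_def intro!: is_term.is_term_Op)
  then show ?case by (simp add: terms_def ac_simps)
qed

text \<open>\<open>subst\<close> restricts every argument function to the arity; this gives back the
  same function because \<open>is_term\<close> makes it extensional.\<close>

lemma subst_Var_id: "is_term \<Sigma> \<Gamma> p t \<Longrightarrow> subst \<Sigma> 0 Var t = t"
proof (induction rule: is_term.induct)
  case (is_term_Op \<sigma> f m)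
  have "restrict (\<lambda>i. subst \<Sigma> 0 Var (f i)) (Field (ar \<Sigma> \<sigma>)) = f"
    by (rule extensionalityI[OF _ is_term_Op(2)]) (auto simp: is_term_Op)
  then show ?case by simp
qed simp

section \<open>Evaluation of terms\<close>

lemma eval_OpI:
  assumes "\<And>i. i \<in> Field (ar \<Sigma> \<sigma>) \<Longrightarrow> eval \<Sigma> A m \<iota> (f i) = Some (a i)"
    and "\<And>i j. (i, j) \<in> ar \<Sigma> \<sigma> \<Longrightarrow> (a i, a j) \<in> car A (m + q)"
  shows "eval \<Sigma> A m \<iota> (Op \<sigma> q f) = Some (opn A \<sigma> (m + q) (restrict a (Field (ar \<Sigma> \<sigma>))))"
proof -
  have "restrict (\<lambda>i. the (eval \<Sigma> A m \<iota> (f i))) (Field (ar \<Sigma> \<sigma>)) = restrict a (Field (ar \<Sigma> \<sigma>))"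
    using assms(1) by (intro restrict_ext) simp
  then show ?thesis
    using assms by (auto simp: FieldI1 FieldI2)
qed

lemma eval_OpE:
  assumes "eval \<Sigma> A m \<iota> (Op \<sigma> q f) = Some b"
  obtains a where "\<And>i. i \<in> Field (ar \<Sigma> \<sigma>) \<Longrightarrow> eval \<Sigma> A m \<iota> (f i) = Some (a i)"
    and "\<And>i j. (i, j) \<in> ar \<Sigma> \<sigma> \<Longrightarrow> (a i, a j) \<in> car A (m + q)"
    and "b = opn A \<sigma> (m + q) (restrict a (Field (ar \<Sigma> \<sigma>)))"
  by (rule that[of "\<lambda>i. the (eval \<Sigma> A m \<iota> (f i))"])
    (use assms in \<open>auto split: if_splits\<close>)

text \<open>An operation evaluates only if all its arguments do. In the soundness of (Ax2) this
  turns satisfaction of an axiom into definedness of its subterms.\<close>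

lemma eval_sub_defined:
  assumes "eval \<Sigma> A m \<iota> t \<noteq> None" "u \<in> sub \<Sigma> t"
  shows "eval \<Sigma> A m \<iota> u \<noteq> None"
  using assms
proof (induction t)
  case (Op \<sigma> q f)
  show ?case
  proof (cases "u = Op \<sigma> q f")
    case False
    then obtain i where "i \<in> Field (ar \<Sigma> \<sigma>)" "u \<in> sub \<Sigma> (f i)"
      using Op.prems(2) by auto
    moreover from this have "eval \<Sigma> A m \<iota> (f i) \<noteq> None"
      using Op.prems(1) by (auto split: if_splits)
    ultimately show ?thesis using Op.IH by blast
  qed (use Op.prems in simp)
qed simp

text \<open>The semantic substitution lemma. The terms \<open>\<gamma> x\<close> take their values
  \<open>k\<close> levels above \<open>m\<close>, so the changed valuation \<open>\<kappa>\<close>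
  starts at \<open>m + k\<close>. The clauses for operations agree because both apply the operation
  with index \<open>m + k + q\<close>. As an equation between options it transfers definedness as
  well as values.\<close>

lemma eval_subst:
  assumes "is_term \<Sigma> \<Delta> p t" "\<And>x. x \<in> Field \<Delta> \<Longrightarrow> eval \<Sigma> A m \<iota> (\<gamma> x) = Some (\<kappa> x)"
  shows "eval \<Sigma> A m \<iota> (subst \<Sigma> k \<gamma> t) = eval \<Sigma> A (m + k) \<kappa> t"
  using assms(1)
proof induction
  case (is_term_Var x)
  then show ?case by (simp add: assms(2))
next
  case (is_term_Op \<sigma> f q)
  let ?F = "Field (ar \<Sigma> \<sigma>)"
  have *: "eval \<Sigma> A m \<iota> (restrict (\<lambda>i. subst \<Sigma> k \<gamma> (f i)) ?F i) = eval \<Sigma> A (m + k) \<kappa> (f i)"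
    if "i \<in> ?F" for i
    using is_term_Op.IH[OF that] that by simp
  have "restrict (\<lambda>i. the (eval \<Sigma> A m \<iota> (restrict (\<lambda>i. subst \<Sigma> k \<gamma> (f i)) ?F i))) ?F =
      restrict (\<lambda>i. the (eval \<Sigma> A (m + k) \<kappa> (f i))) ?F"
    by (intro restrict_ext) (simp only: *)
  moreover have "(\<forall>(i, j) \<in> ar \<Sigma> \<sigma>.
        (the (eval \<Sigma> A m \<iota> (restrict (\<lambda>i. subst \<Sigma> k \<gamma> (f i)) ?F i)),
         the (eval \<Sigma> A m \<iota> (restrict (\<lambda>i. subst \<Sigma> k \<gamma> (f i)) ?F j))) \<in> car A (m + (k + q))) \<longleftrightarrow>
      (\<forall>(i, j) \<in> ar \<Sigma> \<sigma>.
        (the (eval \<Sigma> A (m + k) \<kappa> (f i)), the (eval \<Sigma> A (m + k) \<kappa> (f j))) \<in> car A (m + k + q))"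
    by (intro ball_cong refl) (auto simp only: * FieldI1 FieldI2 add.assoc split: prod.splits)
  moreover have "(\<forall>i \<in> ?F. eval \<Sigma> A m \<iota> (restrict (\<lambda>i. subst \<Sigma> k \<gamma> (f i)) ?F i) \<noteq> None) \<longleftrightarrow>
      (\<forall>i \<in> ?F. eval \<Sigma> A (m + k) \<kappa> (f i) \<noteq> None)"
    by (simp only: * cong: ball_cong)
  ultimately show ?case
    by (simp only: subst.simps eval.simps add.assoc)
qed

section \<open>Derivability for a fixed theory and context\<close>

locale theory_in_context =
  fixes \<Sigma> :: "('o, 'p) signature" and \<E> :: "('o, 'p, 'v) ineq set" and \<Gamma> :: "'x rel"
  assumes graded_theory: "graded_theory \<Sigma> \<E>"
    and context_poset: "Partial_order \<Gamma>"
begin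

lemma arity_poset: "\<sigma> \<in> symbols \<Sigma> \<Longrightarrow> Partial_order (ar \<Sigma> \<sigma>)"
  using graded_theory by (auto simp: graded_theory_def graded_signature_def)

lemma axiomD:
  assumes "(\<Delta>, p, s, t) \<in> \<E>"
  shows "Partial_order \<Delta>" "is_term \<Sigma> \<Delta> p s" "is_term \<Sigma> \<Delta> p t"
  using assms graded_theory by (auto simp: graded_theory_def inequation_def terms_def)

text \<open>\<open>is_term_sub\<close> yields just some depth for the subterm; the number
  \<open>m\<close> stored in \<open>Op\<close> pins down the depth of its arguments.\<close>

lemma axiom_sub_OpD:
  assumes "(\<Delta>, p, s, t) \<in> \<E>" "Op \<sigma> m f \<in> sub \<Sigma> s \<union> sub \<Sigma> t"
  shows "\<sigma> \<in> symbols \<Sigma>" "f \<in> extensional (Field (ar \<Sigma> \<sigma>))"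
    "\<And>i. i \<in> Field (ar \<Sigma> \<sigma>) \<Longrightarrow> is_term \<Sigma> \<Delta> m (f i)"
proof -
  obtain q where "is_term \<Sigma> \<Delta> q (Op \<sigma> m f)"
    using axiomD[OF assms(1)] is_term_sub assms(2) by (metis UnE)
  then show "\<sigma> \<in> symbols \<Sigma>" "f \<in> extensional (Field (ar \<Sigma> \<sigma>))"
    "\<And>i. i \<in> Field (ar \<Sigma> \<sigma>) \<Longrightarrow> is_term \<Sigma> \<Delta> m (f i)"
    by (auto dest: is_term_OpD)
qed

text \<open>Lets the side conditions of the rules, that certain functions take values in terms of
  depth \<open>k\<close>, be read off from derivability.\<close>

lemma derivable_terms:
  "derivable \<Sigma> \<E> \<Gamma> k s t \<Longrightarrow> s \<in> terms \<Sigma> \<Gamma> k \<and> t \<in> terms \<Sigma> \<Gamma> k"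
proof (induction rule: derivable.induct)
  case (Var x y)
  then show ?case by (auto simp: terms_def FieldI1 FieldI2 intro: is_term.intros)
next
  case (Ar \<sigma> f k)
  then have "is_term \<Sigma> \<Gamma> (dp \<Sigma> \<sigma> + k) (Op \<sigma> k f)"
    by (auto simp: terms_def PiE_def intro!: is_term.intros)
  then show ?case by (simp add: terms_def add.commute)
next
  case (Ax1 \<Delta> p s t \<gamma> k)
  then show ?case
    using subst_in_terms[OF axiomD(2)[OF Ax1(1)] Ax1(2)] subst_in_terms[OF axiomD(3)[OF Ax1(1)] Ax1(2)]
    by (simp add: add.commute)
next
  case (Ax2 \<Delta> p s t \<sigma> m f i j \<gamma> k)
  then show ?case
    using subst_in_terms[OF axiom_sub_OpD(3)[OF Ax2(1,2) FieldI1[OF Ax2(3)]] Ax2(4)]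
      subst_in_terms[OF axiom_sub_OpD(3)[OF Ax2(1,2) FieldI2[OF Ax2(3)]] Ax2(4)]
    by (simp add: add.commute)
qed auto

text \<open>A case distinction on \<open>u\<close> suffices. For a variable the claim is the premise
  on \<open>\<gamma>\<close> at a reflexive pair. For an operation, (Ax2) gives the inequations
  between its substituted arguments and (Ar) concludes.\<close>

lemma derivable_subst_sub:
  assumes ax: "(\<Delta>, p, s, t) \<in> \<E>" and u: "u \<in> sub \<Sigma> s \<union> sub \<Sigma> t" "is_term \<Sigma> \<Delta> q u"
    and \<gamma>: "\<gamma> ` Field \<Delta> \<subseteq> terms \<Sigma> \<Gamma> k"
      "\<And>x y. (x, y) \<in> \<Delta> \<Longrightarrow> derivable \<Sigma> \<E> \<Gamma> k (\<gamma> x) (\<gamma> y)"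
  shows "derivable \<Sigma> \<E> \<Gamma> (q + k) (subst \<Sigma> k \<gamma> u) (subst \<Sigma> k \<gamma> u)"
proof (cases u)
  case (Var x)
  then show ?thesis
    using u(2) Field_refl[OF axiomD(1)[OF ax]] \<gamma>(2) by (auto dest!: is_term_VarD)
next
  case (Op \<sigma> m f)
  let ?g = "restrict (\<lambda>i. subst \<Sigma> k \<gamma> (f i)) (Field (ar \<Sigma> \<sigma>))"
  note f = is_term_OpD[OF u(2)[unfolded Op]]
  have "derivable \<Sigma> \<E> \<Gamma> (k + m + dp \<Sigma> \<sigma>) (Op \<sigma> (k + m) ?g) (Op \<sigma> (k + m) ?g)"
  proof (rule derivable.Ar)
    show "?g \<in> Field (ar \<Sigma> \<sigma>) \<rightarrow>\<^sub>E terms \<Sigma> \<Gamma> (k + m)"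
      using subst_in_terms[OF f(4) \<gamma>(1)] by auto
    show "derivable \<Sigma> \<E> \<Gamma> (k + m) (?g i) (?g j)" if "(i, j) \<in> ar \<Sigma> \<sigma>" for i j
      using derivable.Ax2[OF ax u(1)[unfolded Op] that \<gamma>] that
      by (simp add: FieldI1 FieldI2 add.commute)
  qed (rule f(2))
  then show ?thesis using Op f(1) by (simp add: ac_simps)
qed

text \<open>There is no reflexivity rule, since \<open>t \<le> t\<close> expresses that
  \<open>t\<close> is defined. For (Ax1), both sides of the axiom are subterms of it, so
  \<open>derivable_subst_sub\<close> applies; for (Ax2), the rule is used again at
  \<open>(i, i)\<close> and \<open>(j, j)\<close>.\<close>

lemma derivable_refl:
  "derivable \<Sigma> \<E> \<Gamma> k s t \<Longrightarrow> derivable \<Sigma> \<E> \<Gamma> k s s \<and> derivable \<Sigma> \<E> \<Gamma> k t t"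
proof (induction rule: derivable.induct)
  case (Var x y)
  then show ?case
    using Field_refl[OF context_poset] by (auto simp: FieldI1 FieldI2 intro!: derivable.Var)
next
  case (Ar \<sigma> f k)
  then show ?case by (auto intro: derivable.Ar)
next
  case (Ax1 \<Delta> p s t \<gamma> k)
  then show ?case
    using axiomD[OF Ax1(1)] by (auto intro!: derivable_subst_sub[OF Ax1(1)] simp: sub_refl)
next
  case (Ax2 \<Delta> p s t \<sigma> m f i j \<gamma> k)
  have \<sigma>: "Partial_order (ar \<Sigma> \<sigma>)"
    using axiom_sub_OpD(1)[OF Ax2(1,2)] by (rule arity_poset)
  have "(i, i) \<in> ar \<Sigma> \<sigma>" "(j, j) \<in> ar \<Sigma> \<sigma>"
    using Ax2(3) by (auto intro!: Field_refl[OF \<sigma>] simp: FieldI1 FieldI2)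
  then show ?case
    using Ax2 by (auto intro: derivable.Ax2[OF Ax2(1,2)])
qed auto

section \<open>Soundness\<close>

theorem soundness:
  assumes model: "model \<Sigma> \<E> n A"
    and args: "n \<noteq> \<infinity> \<Longrightarrow> \<forall>e \<in> argument_ineqs \<Sigma> \<E>. satisfies \<Sigma> n A e"
    and \<iota>: "\<iota> \<in> Pos \<Gamma> (car A m)"
    and "derivable \<Sigma> \<E> \<Gamma> k s t" "enat (m + k) \<le> n"
  shows "\<exists>a b. eval \<Sigma> A m \<iota> s = Some a \<and> eval \<Sigma> A m \<iota> t = Some b \<and> (a, b) \<in> car A (m + k)"
  using assms(4,5)
proof (induction rule: derivable.induct)
  case (Var x y)
  then show ?case using Pos_mono[OF \<iota>] by simp
next
  case (Ar \<sigma> f k)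
  \<comment> \<open>The premises have depth at most that of the conclusion, so the bound by
    \<open>n\<close> passes down to the induction hypotheses.\<close>
  have le: "enat (m + k) \<le> n" "enat (dp \<Sigma> \<sigma> + (m + k)) \<le> n"
    using Ar.prems by (auto simp: ac_simps elim: order_trans[rotated])
  define a where "a = (\<lambda>i. the (eval \<Sigma> A m \<iota> (f i)))"
  note \<sigma> = arity_poset[OF Ar(1)]
  \<comment> \<open>The induction hypothesis at the reflexive pair \<open>(i, i)\<close> says that
    \<open>f i\<close> is defined.\<close>
  have a: "eval \<Sigma> A m \<iota> (f i) = Some (a i)" if "i \<in> Field (ar \<Sigma> \<sigma>)" for i
    using Ar.IH[OF Field_refl[OF \<sigma> that] le(1)] by (auto simp: a_def)
  have a_mono: "(a i, a j) \<in> car A (m + k)" if "(i, j) \<in> ar \<Sigma> \<sigma>" for i j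
    using Ar.IH[OF that le(1)] by (auto simp: a_def)
  have "opn A \<sigma> (m + k) (restrict a (Field (ar \<Sigma> \<sigma>))) \<in> Field (car A (dp \<Sigma> \<sigma> + (m + k)))"
    using model Ar(1) le(2) restrict_in_Pos[OF \<sigma> a_mono] by (simp add: model_def algebra_def)
  moreover have "Partial_order (car A (dp \<Sigma> \<sigma> + (m + k)))"
    using model le(2) by (simp add: model_def algebra_def)
  ultimately have "(opn A \<sigma> (m + k) (restrict a (Field (ar \<Sigma> \<sigma>))),
      opn A \<sigma> (m + k) (restrict a (Field (ar \<Sigma> \<sigma>)))) \<in> car A (m + (k + dp \<Sigma> \<sigma>))"
    using Field_refl by (simp add: ac_simps)
  then show ?case
    using eval_OpI[OF a a_mono] by (simp del: eval.simps)
next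
  case (Trans k s t u)
  obtain a b where "eval \<Sigma> A m \<iota> s = Some a" "eval \<Sigma> A m \<iota> t = Some b" "(a, b) \<in> car A (m + k)"
    using Trans.IH(1)[OF Trans.prems] by blast
  moreover obtain b' c where "eval \<Sigma> A m \<iota> t = Some b'" "eval \<Sigma> A m \<iota> u = Some c"
      "(b', c) \<in> car A (m + k)"
    using Trans.IH(2)[OF Trans.prems] by blast
  moreover have "Partial_order (car A (m + k))"
    using model Trans.prems by (simp add: model_def algebra_def)
  ultimately show ?case using Partial_order_trans by fastforce
next
  case (Mon \<sigma> f k g)
  have le: "enat (m + k) \<le> n" "enat (dp \<Sigma> \<sigma> + (m + k)) \<le> n"
    using Mon.prems by (auto simp: ac_simps elim: order_trans[rotated])
  \<comment> \<open>The two definedness premises make both operations evaluate;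
    \<open>eval_OpE\<close> then shows that their argument families are monotone, hence in the
    domain of \<open>opn\<close>.\<close>
  obtain b c where b: "eval \<Sigma> A m \<iota> (Op \<sigma> k f) = Some b"
    and c: "eval \<Sigma> A m \<iota> (Op \<sigma> k g) = Some c"
    using Mon.IH(2,3) Mon.prems by blast
  obtain a where a: "\<And>i. i \<in> Field (ar \<Sigma> \<sigma>) \<Longrightarrow> eval \<Sigma> A m \<iota> (f i) = Some (a i)"
      "\<And>i j. (i, j) \<in> ar \<Sigma> \<sigma> \<Longrightarrow> (a i, a j) \<in> car A (m + k)"
      "b = opn A \<sigma> (m + k) (restrict a (Field (ar \<Sigma> \<sigma>)))"
    using b by (rule eval_OpE) blast
  obtain d where d: "\<And>i. i \<in> Field (ar \<Sigma> \<sigma>) \<Longrightarrow> eval \<Sigma> A m \<iota> (g i) = Some (d i)"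
      "\<And>i j. (i, j) \<in> ar \<Sigma> \<sigma> \<Longrightarrow> (d i, d j) \<in> car A (m + k)"
      "c = opn A \<sigma> (m + k) (restrict d (Field (ar \<Sigma> \<sigma>)))"
    using c by (rule eval_OpE) blast
  note \<sigma> = arity_poset[OF Mon(1)]
  have "(a i, d i) \<in> car A (m + k)" if "i \<in> Field (ar \<Sigma> \<sigma>)" for i
    using Mon.IH(1)[OF that le(1)] a(1)[OF that] d(1)[OF that] by auto
  then have "(b, c) \<in> car A (dp \<Sigma> \<sigma> + (m + k))"
    using model Mon(1) le(2) restrict_in_Pos[OF \<sigma> a(2)] restrict_in_Pos[OF \<sigma> d(2)]
    by (simp add: model_def algebra_def a(3) d(3))
  then show ?case using b c by (simp add: ac_simps del: eval.simps)
next
  case (Ax1 \<Delta> p s t \<gamma> k)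
  have le: "enat (m + k) \<le> n" "enat (m + k + p) \<le> n"
    using Ax1.prems by (auto simp: ac_simps elim: order_trans[rotated])
  note ax = axiomD[OF Ax1(1)]
  \<comment> \<open>The substitution followed by evaluation, as a valuation of
    \<open>\<Delta>\<close> at level \<open>m + k\<close>. The induction hypotheses make it total
    and monotone, so the axiom can be instantiated with it.\<close>
  define \<kappa> where "\<kappa> = restrict (\<lambda>x. the (eval \<Sigma> A m \<iota> (\<gamma> x))) (Field \<Delta>)"
  have \<kappa>: "\<kappa> \<in> Pos \<Delta> (car A (m + k))"
    unfolding \<kappa>_def by (rule restrict_in_Pos[OF ax(1)]) (use Ax1.IH le(1) in force)
  have eval_\<gamma>: "eval \<Sigma> A m \<iota> (\<gamma> x) = Some (\<kappa> x)" if "x \<in> Field \<Delta>" for x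
    using Ax1.IH[OF Field_refl[OF ax(1) that] le(1)] that by (auto simp: \<kappa>_def)
  have "satisfies \<Sigma> n A (\<Delta>, p, s, t)"
    using model Ax1(1) by (auto simp: model_def)
  then have "\<exists>a b. eval \<Sigma> A (m + k) \<kappa> s = Some a \<and> eval \<Sigma> A (m + k) \<kappa> t = Some b \<and>
      (a, b) \<in> car A (m + k + p)"
    using le(2) \<kappa> by (auto simp: satisfies_def)
  then show ?case
    using eval_subst[OF ax(2) eval_\<gamma>] eval_subst[OF ax(3) eval_\<gamma>] by (simp add: ac_simps)
next
  case (Ax2 \<Delta> p s t \<sigma> q f i j \<gamma> k)
  have le: "enat (m + k) \<le> n" "enat (m + k + q) \<le> n"
    using Ax2.prems by (auto simp: ac_simps elim: order_trans[rotated])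
  note ax = axiomD[OF Ax2(1)]
  define \<kappa> where "\<kappa> = restrict (\<lambda>x. the (eval \<Sigma> A m \<iota> (\<gamma> x))) (Field \<Delta>)"
  have \<kappa>: "\<kappa> \<in> Pos \<Delta> (car A (m + k))"
    unfolding \<kappa>_def by (rule restrict_in_Pos[OF ax(1)]) (use Ax2.IH le(1) in force)
  have eval_\<gamma>: "eval \<Sigma> A m \<iota> (\<gamma> x) = Some (\<kappa> x)" if "x \<in> Field \<Delta>" for x
    using Ax2.IH[OF Field_refl[OF ax(1) that] le(1)] that by (auto simp: \<kappa>_def)
  have ij: "i \<in> Field (ar \<Sigma> \<sigma>)" "j \<in> Field (ar \<Sigma> \<sigma>)"
    using Ax2(3) by (auto simp: FieldI1 FieldI2)
  have "\<exists>a b. eval \<Sigma> A (m + k) \<kappa> (f i) = Some a \<and> eval \<Sigma> A (m + k) \<kappa> (f j) = Some b \<and>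
      (a, b) \<in> car A (m + k + q)"
  \<comment> \<open>Satisfaction of the axiom at level \<open>m + k\<close> presupposes
    \<open>m + k + p \<le> n\<close>, whereas only \<open>m + k + q \<le> n\<close> is given and
    \<open>q\<close> may be smaller than \<open>p\<close>. For infinite \<open>n\<close> the bound
    always holds; for finite \<open>n\<close> the inequation is taken from
    \<open>args\<close>.\<close>
  proof (cases "n = \<infinity>")
    case True
    have "satisfies \<Sigma> n A (\<Delta>, p, s, t)"
      using model Ax2(1) by (auto simp: model_def)
    then have "eval \<Sigma> A (m + k) \<kappa> s \<noteq> None" "eval \<Sigma> A (m + k) \<kappa> t \<noteq> None"
      using \<kappa> True by (fastforce simp: satisfies_def)+
    \<comment> \<open>An operation is defined only on a monotone family of arguments, and this
      monotonicity is the inequation wanted.\<close>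
    then have "eval \<Sigma> A (m + k) \<kappa> (Op \<sigma> q f) \<noteq> None"
      using eval_sub_defined Ax2(2) by (metis UnE)
    then obtain b where "eval \<Sigma> A (m + k) \<kappa> (Op \<sigma> q f) = Some b"
      unfolding not_None_eq by (rule exE)
    then show ?thesis
      using ij Ax2(3) by (elim eval_OpE) auto
  next
    case False
    have "(\<Delta>, q, f i, f j) \<in> argument_ineqs \<Sigma> \<E>"
      using Ax2(1-3) unfolding argument_ineqs_def by blast
    then show ?thesis
      using args[OF False] \<kappa> le(2) by (fastforce simp: satisfies_def)
  qed
  then show ?case
    using eval_subst[OF axiom_sub_OpD(3)[OF Ax2(1,2) ij(1)] eval_\<gamma>]
      eval_subst[OF axiom_sub_OpD(3)[OF Ax2(1,2) ij(2)] eval_\<gamma>]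
    by (simp add: ac_simps)
qed

section \<open>The term model\<close>

definition term_class :: "nat \<Rightarrow> ('o, 'p, 'x) gterm \<Rightarrow> ('o, 'p, 'x) gterm set" where
  "term_class k t = {u. derivable \<Sigma> \<E> \<Gamma> k t u \<and> derivable \<Sigma> \<E> \<Gamma> k u t}"

text \<open>Lifts a family of classes to a family of terms, from which \<open>opn\<close> can build
  a term.\<close>

definition rep :: "('o, 'p, 'x) gterm set \<Rightarrow> ('o, 'p, 'x) gterm" where
  "rep X = (SOME t. t \<in> X)"

text \<open>Since the carrier is the image of derivability, \<open>derivable_refl\<close> ensures
  that it contains only classes of terms that are derivably defined. All levels are filled in at
  once, so the same structure serves for every \<open>n\<close>.\<close>

definition term_model :: "('o, 'p, ('o, 'p, 'x) gterm set) galg" where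
  "term_model = \<lparr>
     car = (\<lambda>k. {(term_class k s, term_class k t) | s t. derivable \<Sigma> \<E> \<Gamma> k s t}),
     opn = (\<lambda>\<sigma> k F. term_class (dp \<Sigma> \<sigma> + k) (Op \<sigma> k (restrict (\<lambda>i. rep (F i)) (Field (ar \<Sigma> \<sigma>)))))\<rparr>"

lemma term_class_eqI:
  assumes "derivable \<Sigma> \<E> \<Gamma> k s t" "derivable \<Sigma> \<E> \<Gamma> k t s"
  shows "term_class k s = term_class k t"
  using assms unfolding term_class_def by (blast intro: derivable.Trans)

text \<open>Terms that are not derivably defined all have the empty class; definedness of
  \<open>t\<close> puts \<open>t\<close> into its own class and makes equality informative.\<close>

lemma term_class_eqD:
  assumes "term_class k s = term_class k t" "derivable \<Sigma> \<E> \<Gamma> k t t"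
  shows "derivable \<Sigma> \<E> \<Gamma> k s t" "derivable \<Sigma> \<E> \<Gamma> k t s"
proof -
  have "t \<in> term_class k s"
    unfolding assms(1) using assms(2) by (simp add: term_class_def)
  then show "derivable \<Sigma> \<E> \<Gamma> k s t" "derivable \<Sigma> \<E> \<Gamma> k t s"
    by (simp_all add: term_class_def)
qed

lemma rep_term_class:
  assumes "derivable \<Sigma> \<E> \<Gamma> k t t"
  shows "derivable \<Sigma> \<E> \<Gamma> k t (rep (term_class k t))" "derivable \<Sigma> \<E> \<Gamma> k (rep (term_class k t)) t"
proof -
  have "t \<in> term_class k t"
    using assms by (simp add: term_class_def)
  then have "rep (term_class k t) \<in> term_class k t"
    unfolding rep_def by (rule someI)
  then show "derivable \<Sigma> \<E> \<Gamma> k t (rep (term_class k t))"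
    "derivable \<Sigma> \<E> \<Gamma> k (rep (term_class k t)) t"
    by (simp_all add: term_class_def)
qed

lemma car_term_modelI:
  "derivable \<Sigma> \<E> \<Gamma> k s t \<Longrightarrow> (term_class k s, term_class k t) \<in> car term_model k"
  by (auto simp: term_model_def)

text \<open>Membership in the carrier only provides some derivable \<open>s' \<le> t'\<close>
  between members of the classes; (Trans) moves it to \<open>s\<close> and \<open>t\<close>.\<close>

lemma car_term_modelD:
  assumes "(term_class k s, term_class k t) \<in> car term_model k"
    and "derivable \<Sigma> \<E> \<Gamma> k s s" "derivable \<Sigma> \<E> \<Gamma> k t t"
  shows "derivable \<Sigma> \<E> \<Gamma> k s t"
proof -
  obtain s' t' where st: "term_class k s' = term_class k s" "term_class k t' = term_class k t"
      "derivable \<Sigma> \<E> \<Gamma> k s' t'"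
    using assms(1) by (auto simp: term_model_def)
  show ?thesis
    using term_class_eqD(2)[OF st(1) assms(2)] st(3) term_class_eqD(1)[OF st(2) assms(3)]
    by (blast intro: derivable.Trans)
qed

lemma Field_car_term_model:
  "Field (car term_model k) = {term_class k t | t. derivable \<Sigma> \<E> \<Gamma> k t t}"
  by (auto simp: Field_def term_model_def dest: derivable_refl)

lemma term_class_rep:
  assumes "X \<in> Field (car term_model k)"
  shows "term_class k (rep X) = X" "derivable \<Sigma> \<E> \<Gamma> k (rep X) (rep X)"
proof -
  obtain t where t: "X = term_class k t" "derivable \<Sigma> \<E> \<Gamma> k t t"
    using assms by (auto simp: Field_car_term_model)
  note r = rep_term_class[OF t(2)]
  show "term_class k (rep X) = X" "derivable \<Sigma> \<E> \<Gamma> k (rep X) (rep X)"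
    unfolding t(1) by (rule term_class_eqI[OF r(2,1)], rule derivable.Trans[OF r(2,1)])
qed

lemma derivable_rep:
  assumes "(X, Y) \<in> car term_model k"
  shows "derivable \<Sigma> \<E> \<Gamma> k (rep X) (rep Y)"
proof -
  note X = term_class_rep[OF FieldI1[OF assms]]
  note Y = term_class_rep[OF FieldI2[OF assms]]
  show ?thesis
    by (rule car_term_modelD) (simp_all add: X Y assms)
qed

lemma Partial_order_term_model: "Partial_order (car term_model k)"
proof -
  have "refl_on (Field (car term_model k)) (car term_model k)"
    by (auto simp: refl_on_def Field_car_term_model intro: car_term_modelI)
  moreover have "trans (car term_model k)"
  proof (rule transI)
    fix X Y Z
    assume *: "(X, Y) \<in> car term_model k" "(Y, Z) \<in> car term_model k"
    then have "derivable \<Sigma> \<E> \<Gamma> k (rep X) (rep Z)"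
      by (blast intro: derivable.Trans derivable_rep)
    from car_term_modelI[OF this] show "(X, Z) \<in> car term_model k"
      using * by (simp add: term_class_rep FieldI1 FieldI2)
  qed
  moreover have "antisym (car term_model k)"
  proof (rule antisymI)
    fix X Y
    assume *: "(X, Y) \<in> car term_model k" "(Y, X) \<in> car term_model k"
    then have "term_class k (rep X) = term_class k (rep Y)"
      by (intro term_class_eqI derivable_rep)
    then show "X = Y"
      using * by (simp add: term_class_rep FieldI1)
  qed
  ultimately show ?thesis
    by (auto simp: partial_order_on_def preorder_on_def Field_def)
qed

text \<open>(Ar) with its side condition discharged: monotonicity at reflexive pairs makes each
  \<open>f i\<close> derivably defined, hence a term of depth \<open>k\<close>.\<close>

lemma derivable_Op:
  assumes "\<sigma> \<in> symbols \<Sigma>" "f \<in> extensional (Field (ar \<Sigma> \<sigma>))"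
    and "\<And>i j. (i, j) \<in> ar \<Sigma> \<sigma> \<Longrightarrow> derivable \<Sigma> \<E> \<Gamma> k (f i) (f j)"
  shows "f \<in> Field (ar \<Sigma> \<sigma>) \<rightarrow>\<^sub>E terms \<Sigma> \<Gamma> k"
    and "derivable \<Sigma> \<E> \<Gamma> (k + dp \<Sigma> \<sigma>) (Op \<sigma> k f) (Op \<sigma> k f)"
proof -
  have "f i \<in> terms \<Sigma> \<Gamma> k" if "i \<in> Field (ar \<Sigma> \<sigma>)" for i
    using assms(3)[OF Field_refl[OF arity_poset[OF assms(1)] that]] derivable_terms by blast
  then show f: "f \<in> Field (ar \<Sigma> \<sigma>) \<rightarrow>\<^sub>E terms \<Sigma> \<Gamma> k"
    using assms(2) by (auto simp: PiE_def)
  show "derivable \<Sigma> \<E> \<Gamma> (k + dp \<Sigma> \<sigma>) (Op \<sigma> k f) (Op \<sigma> k f)"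
    by (rule derivable.Ar[OF assms(1) f assms(3)])
qed

lemma derivable_Op_mono:
  assumes "\<sigma> \<in> symbols \<Sigma>"
    and "f \<in> extensional (Field (ar \<Sigma> \<sigma>))" "g \<in> extensional (Field (ar \<Sigma> \<sigma>))"
    and "\<And>i j. (i, j) \<in> ar \<Sigma> \<sigma> \<Longrightarrow> derivable \<Sigma> \<E> \<Gamma> k (f i) (f j)"
    and "\<And>i j. (i, j) \<in> ar \<Sigma> \<sigma> \<Longrightarrow> derivable \<Sigma> \<E> \<Gamma> k (g i) (g j)"
    and "\<And>i. i \<in> Field (ar \<Sigma> \<sigma>) \<Longrightarrow> derivable \<Sigma> \<E> \<Gamma> k (f i) (g i)"
  shows "derivable \<Sigma> \<E> \<Gamma> (dp \<Sigma> \<sigma> + k) (Op \<sigma> k f) (Op \<sigma> k g)"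
  using derivable.Mon[OF assms(1) derivable_Op(1)[OF assms(1,2,4)] derivable_Op(1)[OF assms(1,3,5)]
      assms(6) derivable_Op(2)[OF assms(1,2,4)] derivable_Op(2)[OF assms(1,3,5)]]
  by (simp add: add.commute)

text \<open>Independence of representatives. The chosen family \<open>?h\<close> is componentwise
  derivably equal to \<open>g\<close>, so (Mon) in both directions identifies the two operation
  terms.\<close>

lemma opn_term_model:
  assumes \<sigma>: "\<sigma> \<in> symbols \<Sigma>" and g: "g \<in> extensional (Field (ar \<Sigma> \<sigma>))"
    and mono: "\<And>i j. (i, j) \<in> ar \<Sigma> \<sigma> \<Longrightarrow> derivable \<Sigma> \<E> \<Gamma> k (g i) (g j)"
  shows "opn term_model \<sigma> k (restrict (\<lambda>i. term_class k (g i)) (Field (ar \<Sigma> \<sigma>))) =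
    term_class (dp \<Sigma> \<sigma> + k) (Op \<sigma> k g)"
proof -
  let ?h = "restrict (\<lambda>i. rep (term_class k (g i))) (Field (ar \<Sigma> \<sigma>))"
  have gh: "derivable \<Sigma> \<E> \<Gamma> k (g i) (?h i)" "derivable \<Sigma> \<E> \<Gamma> k (?h i) (g i)"
    if "i \<in> Field (ar \<Sigma> \<sigma>)" for i
    using rep_term_class[OF mono[OF Field_refl[OF arity_poset[OF \<sigma>] that]]] that by simp_all
  have h: "derivable \<Sigma> \<E> \<Gamma> k (?h i) (?h j)" if "(i, j) \<in> ar \<Sigma> \<sigma>" for i j
    by (rule derivable.Trans[OF gh(2)[OF FieldI1[OF that]]
          derivable.Trans[OF mono[OF that] gh(1)[OF FieldI2[OF that]]]])
  have "term_class (dp \<Sigma> \<sigma> + k) (Op \<sigma> k ?h) = term_class (dp \<Sigma> \<sigma> + k) (Op \<sigma> k g)"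
    by (intro term_class_eqI derivable_Op_mono \<sigma> g mono h gh) auto
  moreover have "restrict (\<lambda>i. rep (restrict (\<lambda>i. term_class k (g i)) (Field (ar \<Sigma> \<sigma>)) i))
      (Field (ar \<Sigma> \<sigma>)) = ?h"
    by (rule restrict_ext) simp
  ultimately show ?thesis by (simp add: term_model_def)
qed

lemma algebra_term_model: "algebra \<Sigma> n term_model"
  unfolding algebra_def
proof (intro conjI allI ballI impI)
  fix \<sigma> k F G
  let ?r = "\<lambda>F. restrict (\<lambda>i. rep (F i)) (Field (ar \<Sigma> \<sigma>))"
  assume \<sigma>: "\<sigma> \<in> symbols \<Sigma>"
  \<comment> \<open>A monotone family of classes lifts to representatives that satisfy the premises
    of (Ar).\<close>
  have r: "derivable \<Sigma> \<E> \<Gamma> k (?r F i) (?r F j)"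
    if "F \<in> Pos (ar \<Sigma> \<sigma>) (car term_model k)" "(i, j) \<in> ar \<Sigma> \<sigma>" for F i j
    using derivable_rep[OF Pos_mono[OF that]] that(2) by (simp add: FieldI1 FieldI2)
  assume F: "F \<in> Pos (ar \<Sigma> \<sigma>) (car term_model k)"
  show "opn term_model \<sigma> k F \<in> Field (car term_model (dp \<Sigma> \<sigma> + k))"
    using derivable_Op(2)[OF \<sigma> restrict_extensional r[OF F], unfolded add.commute[of k]]
    unfolding Field_car_term_model by (auto simp: term_model_def simp del: restrict_apply)
  assume G: "G \<in> Pos (ar \<Sigma> \<sigma>) (car term_model k)"
    and FG: "\<forall>i \<in> Field (ar \<Sigma> \<sigma>). (F i, G i) \<in> car term_model k"
  have "derivable \<Sigma> \<E> \<Gamma> (dp \<Sigma> \<sigma> + k) (Op \<sigma> k (?r F)) (Op \<sigma> k (?r G))"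
    using FG by (intro derivable_Op_mono \<sigma> r F G) (auto intro: derivable_rep)
  from car_term_modelI[OF this]
  show "(opn term_model \<sigma> k F, opn term_model \<sigma> k G) \<in> car term_model (dp \<Sigma> \<sigma> + k)"
    by (simp add: term_model_def)
qed (rule Partial_order_term_model)

section \<open>Evaluation in the term model\<close>

lemma eval_term_model_Op:
  assumes "\<sigma> \<in> symbols \<Sigma>"
    and ev: "\<And>i. i \<in> Field (ar \<Sigma> \<sigma>) \<Longrightarrow>
      eval \<Sigma> term_model m \<iota> (f i) = Some (term_class (m + q) (subst \<Sigma> m \<gamma> (f i)))"
    and mono: "\<And>i j. (i, j) \<in> ar \<Sigma> \<sigma> \<Longrightarrow>
      derivable \<Sigma> \<E> \<Gamma> (m + q) (subst \<Sigma> m \<gamma> (f i)) (subst \<Sigma> m \<gamma> (f j))"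
  shows "eval \<Sigma> term_model m \<iota> (Op \<sigma> q f) =
      Some (term_class (m + (dp \<Sigma> \<sigma> + q)) (subst \<Sigma> m \<gamma> (Op \<sigma> q f)))"
    and "derivable \<Sigma> \<E> \<Gamma> (m + (dp \<Sigma> \<sigma> + q)) (subst \<Sigma> m \<gamma> (Op \<sigma> q f)) (subst \<Sigma> m \<gamma> (Op \<sigma> q f))"
proof -
  let ?g = "restrict (\<lambda>i. subst \<Sigma> m \<gamma> (f i)) (Field (ar \<Sigma> \<sigma>))"
  have g: "derivable \<Sigma> \<E> \<Gamma> (m + q) (?g i) (?g j)" if "(i, j) \<in> ar \<Sigma> \<sigma>" for i j
    using mono[OF that] that by (simp add: FieldI1 FieldI2)
  \<comment> \<open>The arguments evaluate to the classes of \<open>?g i\<close>;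
    \<open>opn_term_model\<close> then replaces the chosen representatives by
    \<open>?g\<close>.\<close>
  have "eval \<Sigma> term_model m \<iota> (Op \<sigma> q f) = Some (opn term_model \<sigma> (m + q)
      (restrict (\<lambda>i. term_class (m + q) (?g i)) (Field (ar \<Sigma> \<sigma>))))"
    by (rule eval_OpI) (simp add: ev, rule car_term_modelI[OF g])
  then show "eval \<Sigma> term_model m \<iota> (Op \<sigma> q f) =
      Some (term_class (m + (dp \<Sigma> \<sigma> + q)) (subst \<Sigma> m \<gamma> (Op \<sigma> q f)))"
    using opn_term_model[OF assms(1) restrict_extensional g]
    by (simp add: ac_simps del: restrict_apply eval.simps)
  show "derivable \<Sigma> \<E> \<Gamma> (m + (dp \<Sigma> \<sigma> + q)) (subst \<Sigma> m \<gamma> (Op \<sigma> q f)) (subst \<Sigma> m \<gamma> (Op \<sigma> q f))"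
    using derivable_Op(2)[OF assms(1) restrict_extensional g]
    by (simp add: ac_simps del: restrict_apply)
qed

text \<open>Here successful evaluation is given and derivability is extracted: the inequalities
  checked between argument values become derivable inequations. The two conclusions are proved
  together because \<open>car_term_modelD\<close> asks for definedness of the arguments.\<close>

lemma eval_term_model:
  assumes "is_term \<Sigma> \<Delta> q u" "eval \<Sigma> term_model m \<iota> u = Some a"
    and "\<And>x. x \<in> Field \<Delta> \<Longrightarrow> \<iota> x = term_class m (\<gamma> x)"
    and "\<And>x. x \<in> Field \<Delta> \<Longrightarrow> derivable \<Sigma> \<E> \<Gamma> m (\<gamma> x) (\<gamma> x)"
  shows "a = term_class (m + q) (subst \<Sigma> m \<gamma> u) \<and>
    derivable \<Sigma> \<E> \<Gamma> (m + q) (subst \<Sigma> m \<gamma> u) (subst \<Sigma> m \<gamma> u)"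
  using assms(1,2)
proof (induction arbitrary: a rule: is_term.induct)
  case (is_term_Var x)
  then show ?case using assms(3,4) by simp
next
  case (is_term_Op \<sigma> f q)
  obtain b where b: "\<And>i. i \<in> Field (ar \<Sigma> \<sigma>) \<Longrightarrow> eval \<Sigma> term_model m \<iota> (f i) = Some (b i)"
      "\<And>i j. (i, j) \<in> ar \<Sigma> \<sigma> \<Longrightarrow> (b i, b j) \<in> car term_model (m + q)"
    using is_term_Op.prems by (rule eval_OpE) blast
  have IH: "b i = term_class (m + q) (subst \<Sigma> m \<gamma> (f i))"
      "derivable \<Sigma> \<E> \<Gamma> (m + q) (subst \<Sigma> m \<gamma> (f i)) (subst \<Sigma> m \<gamma> (f i))"
    if "i \<in> Field (ar \<Sigma> \<sigma>)" for i
    using is_term_Op.IH[OF that b(1)[OF that]] by auto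
  have "derivable \<Sigma> \<E> \<Gamma> (m + q) (subst \<Sigma> m \<gamma> (f i)) (subst \<Sigma> m \<gamma> (f j))"
    if "(i, j) \<in> ar \<Sigma> \<sigma>" for i j
    using b(2)[OF that] IH[OF FieldI1[OF that]] IH[OF FieldI2[OF that]]
    by (auto intro: car_term_modelD)
  note op = eval_term_model_Op[OF is_term_Op(1) _ this, of \<iota>]
  show ?case
    using op is_term_Op.prems b(1) IH(1) by simp
qed

text \<open>Conversely, evaluation is shown to succeed: (Ax2) supplies the monotonicity of the
  arguments at every operation in an axiom. The claim ranges over all subterms so that the induction
  can descend to arguments.\<close>

lemma eval_term_model_axiom:
  assumes ax: "(\<Delta>, p, s, t) \<in> \<E>" and "is_term \<Sigma> \<Delta> q u" "u \<in> sub \<Sigma> s \<union> sub \<Sigma> t"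
    and \<gamma>: "\<gamma> ` Field \<Delta> \<subseteq> terms \<Sigma> \<Gamma> m"
      "\<And>x y. (x, y) \<in> \<Delta> \<Longrightarrow> derivable \<Sigma> \<E> \<Gamma> m (\<gamma> x) (\<gamma> y)"
    and \<iota>: "\<And>x. x \<in> Field \<Delta> \<Longrightarrow> \<iota> x = term_class m (\<gamma> x)"
  shows "eval \<Sigma> term_model m \<iota> u = Some (term_class (m + q) (subst \<Sigma> m \<gamma> u))"
  using assms(2,3)
proof (induction rule: is_term.induct)
  case (is_term_Var x)
  then show ?case using \<iota> by simp
next
  case (is_term_Op \<sigma> f q)
  show ?case
  proof (rule eval_term_model_Op(1)[OF is_term_Op(1)])
    show "eval \<Sigma> term_model m \<iota> (f i) = Some (term_class (m + q) (subst \<Sigma> m \<gamma> (f i)))"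
      if "i \<in> Field (ar \<Sigma> \<sigma>)" for i
      using is_term_Op.IH[OF that] is_term_Op.prems sub_arg that by fast
    show "derivable \<Sigma> \<E> \<Gamma> (m + q) (subst \<Sigma> m \<gamma> (f i)) (subst \<Sigma> m \<gamma> (f j))"
      if "(i, j) \<in> ar \<Sigma> \<sigma>" for i j
      using derivable.Ax2[OF ax is_term_Op.prems that \<gamma>] by (simp add: add.commute)
  qed
qed

lemma satisfies_term_model_axiom:
  assumes ax: "(\<Delta>, p, s, t) \<in> \<E>"
  shows "satisfies \<Sigma> n term_model (\<Delta>, p, s, t)"
proof -
  have "\<exists>a b. eval \<Sigma> term_model m \<iota> s = Some a \<and> eval \<Sigma> term_model m \<iota> t = Some b \<and>
      (a, b) \<in> car term_model (m + p)" if \<iota>: "\<iota> \<in> Pos \<Delta> (car term_model m)" for m \<iota>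
  proof -
    \<comment> \<open>Choosing representatives turns the valuation into a uniform substitution
      satisfying the premises of (Ax1) and (Ax2).\<close>
    let ?\<gamma> = "\<lambda>x. rep (\<iota> x)"
    have \<gamma>: "derivable \<Sigma> \<E> \<Gamma> m (?\<gamma> x) (?\<gamma> y)" if "(x, y) \<in> \<Delta>" for x y
      by (rule derivable_rep[OF Pos_mono[OF \<iota> that]])
    have \<iota>_Field: "\<iota> x \<in> Field (car term_model m)" if "x \<in> Field \<Delta>" for x
      using \<iota> that by (auto simp: Pos_def)
    have \<gamma>_terms: "?\<gamma> ` Field \<Delta> \<subseteq> terms \<Sigma> \<Gamma> m"
      using term_class_rep(2)[OF \<iota>_Field] derivable_terms by blast
    have ev: "eval \<Sigma> term_model m \<iota> u = Some (term_class (m + p) (subst \<Sigma> m ?\<gamma> u))"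
      if "is_term \<Sigma> \<Delta> p u" "u \<in> sub \<Sigma> s \<union> sub \<Sigma> t" for u
      using eval_term_model_axiom[OF ax that \<gamma>_terms \<gamma>] term_class_rep(1)[OF \<iota>_Field] by simp
    have "derivable \<Sigma> \<E> \<Gamma> (m + p) (subst \<Sigma> m ?\<gamma> s) (subst \<Sigma> m ?\<gamma> t)"
      using derivable.Ax1[OF ax \<gamma>_terms \<gamma>] by (simp add: add.commute)
    then show ?thesis
      using ev[OF axiomD(2)[OF ax]] ev[OF axiomD(3)[OF ax]]
      by (auto simp: sub_refl intro: car_term_modelI)
  qed
  then show ?thesis by (simp add: satisfies_def)
qed

lemma model_term_model: "model \<Sigma> \<E> n term_model"
  unfolding model_def using algebra_term_model satisfies_term_model_axiom by auto

section \<open>Completeness\<close>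

theorem completeness:
  assumes st: "is_term \<Sigma> \<Gamma> k s" "is_term \<Sigma> \<Gamma> k t"
    and "enat k \<le> n" and sat: "satisfies \<Sigma> n term_model (\<Gamma>, k, s, t)"
  shows "derivable \<Sigma> \<E> \<Gamma> k s t"
proof -
  \<comment> \<open>The canonical valuation lives at level 0, so \<open>enat k \<le> n\<close> is
    what allows \<open>sat\<close> to be applied to it. For \<open>k\<close> above \<open>n\<close>,
    satisfaction would hold vacuously.\<close>
  define \<iota> where "\<iota> = restrict (\<lambda>x. term_class 0 (Var x)) (Field \<Gamma>)"
  have "\<iota> \<in> Pos \<Gamma> (car term_model 0)"
    unfolding \<iota>_def
    by (rule restrict_in_Pos[OF context_poset car_term_modelI[OF derivable.Var]])
  then obtain a b where ab: "eval \<Sigma> term_model 0 \<iota> s = Some a" "eval \<Sigma> term_model 0 \<iota> t = Some b"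
      "(a, b) \<in> car term_model k"
    using sat[unfolded satisfies_def prod.case, rule_format, of 0 \<iota>] \<open>enat k \<le> n\<close> by auto
  \<comment> \<open>\<open>eval_term_model\<close> with the substitution \<open>Var\<close> at level
    0, which is the identity.\<close>
  have ev: "c = term_class k u \<and> derivable \<Sigma> \<E> \<Gamma> k u u"
    if "is_term \<Sigma> \<Gamma> k u" "eval \<Sigma> term_model 0 \<iota> u = Some c" for u c
    using eval_term_model[OF that, of Var] subst_Var_id[OF that(1)]
    by (simp add: \<iota>_def derivable.Var Field_refl[OF context_poset])
  show ?thesis
    using ev[OF st(1) ab(1)] ev[OF st(2) ab(2)] ab(3) by (auto intro: car_term_modelD)
qed

end

text \<open>A formula cannot quantify over types, so each direction fixes its carriers: an arbitrary
  type \<open>'a\<close> for soundness, sets of terms for completeness, where the term model lives.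
  For finite \<open>n\<close>, soundness is conditional on every model over \<open>'a\<close>
  satisfying the argument inequations behind (Ax2).\<close>

theorem mainTheorem3:
  fixes \<Sigma> :: "('o, 'p) signature" and \<E> :: "('o, 'p, 'v) ineq set" and n :: enat
    and \<Gamma> :: "'x rel" and k :: nat and s t :: "('o, 'p, 'x) gterm"
  assumes "graded_theory \<Sigma> \<E>"
    and "inequation \<Sigma> (\<Gamma>, k, s, t)"
  shows
    "((n \<noteq> \<infinity> \<longrightarrow> (\<forall>A :: ('o, 'p, 'a) galg. model \<Sigma> \<E> n A \<longrightarrow>
                    (\<forall>e \<in> argument_ineqs \<Sigma> \<E>. satisfies \<Sigma> n A e))) \<longrightarrow>
      derivable \<Sigma> \<E> \<Gamma> k s t \<longrightarrow>
      (\<forall>A :: ('o, 'p, 'a) galg. model \<Sigma> \<E> n A \<longrightarrow> satisfies \<Sigma> n A (\<Gamma>, k, s, t)))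
     \<and>
     (enat k \<le> n \<longrightarrow>
      (\<forall>A :: ('o, 'p, ('o, 'p, 'x) gterm set) galg.
         model \<Sigma> \<E> n A \<longrightarrow> satisfies \<Sigma> n A (\<Gamma>, k, s, t)) \<longrightarrow>
      derivable \<Sigma> \<E> \<Gamma> k s t)"
proof -
  interpret theory_in_context \<Sigma> \<E> \<Gamma>
    using assms by unfold_locales (auto simp: inequation_def)
  have st: "is_term \<Sigma> \<Gamma> k s" "is_term \<Sigma> \<Gamma> k t"
    using assms(2) by (auto simp: inequation_def terms_def)
  show ?thesis
  proof (intro conjI impI allI)
    fix A :: "('o, 'p, 'a) galg"
    assume args: "n \<noteq> \<infinity> \<longrightarrow> (\<forall>A :: ('o, 'p, 'a) galg. model \<Sigma> \<E> n A \<longrightarrow>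
        (\<forall>e \<in> argument_ineqs \<Sigma> \<E>. satisfies \<Sigma> n A e))"
      and der: "derivable \<Sigma> \<E> \<Gamma> k s t" and A: "model \<Sigma> \<E> n A"
    show "satisfies \<Sigma> n A (\<Gamma>, k, s, t)"
      unfolding satisfies_def prod.case
      by (intro allI impI ballI, rule soundness[OF A _ _ der]) (use args A in blast)+
  next
    assume "enat k \<le> n" and "\<forall>A :: ('o, 'p, ('o, 'p, 'x) gterm set) galg.
        model \<Sigma> \<E> n A \<longrightarrow> satisfies \<Sigma> n A (\<Gamma>, k, s, t)"
    then show "derivable \<Sigma> \<E> \<Gamma> k s t"
      using completeness[OF st] model_term_model by blast
  qed
qed

end
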